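(* Let $A\in\mathbb{R}^{n\times n}$ and let $AV=VH_{k+p}+r_{k+p}e_{k+p}^T$ be a $(k+p)$-step randomized Arnoldi factorization with sketching matrix $\Omega$. Let $\mathcal{Q}=Q^1\cdots Q^p$ and $H^+_{k+p}=\mathcal{Q}^TH_{k+p}\mathcal{Q}$ be obtained by $p$ shifted QR steps applied to $H_{k+p}$ with shifts $\mu_1,\dots,\mu_p$. Set $$\tilde V=V\mathcal{Q}(:,1{:}k),\qquad \tilde H_k=H^+_{k+p}(1{:}k,1{:}k),\qquad \tilde r_k=H^+_{k+p}(k+1,k)\,V\mathcal{Q}(:,k+1)+\mathcal{Q}(k+p,k)\,r_{k+p}.$$ Then $$A\tilde V=\tilde V\tilde H_k+\tilde r_ke_k^T,$$ where $\tilde V$ is $\Omega$-orthonormal, $\tilde H_k$ is upper Hessenberg, and $\tilde r_k$ is $\Omega$-orthogonal to the columns of $\tilde V$.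
   Context: All inner products and norms are Euclidean. For $\Omega\in\mathbb{R}^{d\times n}$: $\Omega$ is an $\epsilon$-embedding for a subspace $\mathcal{S}\subset\mathbb{R}^n$ (with $\epsilon\in[0,1)$) if $(1-\epsilon)\|x\|^2\le\|\Omega x\|^2\le(1+\epsilon)\|x\|^2$ for all $x\in\mathcal{S}$. Vectors $x,y$ are $\Omega$-orthogonal if $(\Omega x)^T(\Omega y)=0$; a matrix $V$ with $m$ columns is $\Omega$-orthonormal if $(\Omega V)^T(\Omega V)=I_m$. Randomized Arnoldi factorization of length $m$ (here $m=k+p$): given $v_1\in\mathbb{R}^n$ with $\|\Omega v_1\|=1$, let $\mathcal{K}_m=\mathrm{span}\{v_1,Av_1,\dots,A^{m-1}v_1\}$ be of dimension $m$ and let $\Omega$ be an $\epsilon$-embedding for $\mathrm{span}\{\mathcal{K}_m,A\mathcal{K}_m\}$. The factorization is $AV=VH_m+r_me_m^T$, with $V\in\mathbb{R}^{n\times m}$ an $\Omega$-orthonormal basis of $\mathcal{K}_m$, $V(:,1)=v_1$, $H_m\in\mathbb{R}^{m\times m}$ upper Hessenberg with positive subdiagonal entries, and $r_m\in\mathcal{K}_{m+1}$ $\Omega$-orthogonal to $\mathcal{K}_m$. Shifted QR steps: set $H^+:=H_{k+p}$; for $i=1,\dots,p$, compute a QR factorization $H^+-\mu_iI=Q^iR^i$ of the upper Hessenberg matrix $H^+-\mu_iI$, with $R^i$ upper triangular and $Q^i$ orthogonal and upper Hessenberg (as the QR factor of an upper Hessenberg matrix is, e.g. when computed by Givens rotations),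 then replace $H^+$ by $(Q^i)^TH^+Q^i=R^iQ^i+\mu_iI$. The final $H^+$ is $H^+_{k+p}$. If complex shifts are used, orthogonal is replaced by unitary and transposes by conjugate transposes. Notation $M(:,1{:}k)$ means the first $k$ columns, $M(i,j)$ an entry. *)

theory Defs
  imports "Jordan_Normal_Form.Schur_Decomposition" "Jordan_Normal_Form.VS_Connect"
begin

text \<open>Indices start at 0, so the entry \<open>M(i,j)\<close> of the usual 1-based notation is \<open>M $$ (i-1, j-1)\<close> and \<open>e\<^sub>k\<close> in dimension \<open>k\<close> is
  \<open>unit_vec k (k-1)\<close>. Notions involving an adjoint are polymorphic in the field: over the reals
  \<open>conjugate\<close> is the identity and \<open>mat_adjoint\<close> is the transpose.\<close>

lemma mat_adjoint_index [simp]: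
  assumes "i < dim_col M" "j < dim_row M"
  shows "mat_adjoint M $$ (i, j) = conjugate (M $$ (j, i))"
  using assms by (simp add: mat_adjoint_def mat_of_rows_index)

lemma mat_adjoint_dim [simp]:
  "dim_row (mat_adjoint M) = dim_col M" "dim_col (mat_adjoint M) = dim_row M"
  by (simp_all add: mat_adjoint_def)

lemma mat_adjoint_real:
  fixes M :: "real mat"
  shows "mat_adjoint M = transpose_mat M"
  by (rule eq_matI) auto

definition euclidean_norm :: "real vec \<Rightarrow> real" where
  "euclidean_norm x = sqrt (x \<bullet> x)"

definition outer_product :: "'a::times vec \<Rightarrow> 'a vec \<Rightarrow> 'a mat" where
  "outer_product x y = mat (dim_vec x) (dim_vec y) (\<lambda>(i, j). x $ i * y $ j)"

text \<open>\<open>M(1:a, 1:b)\<close>\<close>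
definition leading_block :: "'a mat \<Rightarrow> nat \<Rightarrow> nat \<Rightarrow> 'a mat" where
  "leading_block M a b = mat a b (\<lambda>(i, j). M $$ (i, j))"

definition upper_hessenberg :: "'a::zero mat \<Rightarrow> bool" where
  "upper_hessenberg M \<longleftrightarrow>
     (\<forall>i < dim_row M. \<forall>j < dim_col M. j + 1 < i \<longrightarrow> M $$ (i, j) = 0)"

definition unitary_mat :: "nat \<Rightarrow> 'a::conjugatable_field mat \<Rightarrow> bool" where
  "unitary_mat m Q \<longleftrightarrow> Q \<in> carrier_mat m m \<and> mat_adjoint Q * Q = 1\<^sub>m m \<and> Q * mat_adjoint Q = 1\<^sub>m m"


section \<open>Sketching\<close>

abbreviation span_in :: "nat \<Rightarrow> real vec set \<Rightarrow> real vec set" where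
  "span_in n \<equiv> LinearCombinations.module.span class_ring (module_vec TYPE(real) n)"

definition eps_embedding :: "real \<Rightarrow> real mat \<Rightarrow> real vec set \<Rightarrow> bool" where
  "eps_embedding \<epsilon> \<Omega> S \<longleftrightarrow> 0 \<le> \<epsilon> \<and> \<epsilon> < 1 \<and>
     (\<forall>x\<in>S. (1 - \<epsilon>) * (euclidean_norm x)\<^sup>2 \<le> (euclidean_norm (\<Omega> *\<^sub>v x))\<^sup>2 \<and>
            (euclidean_norm (\<Omega> *\<^sub>v x))\<^sup>2 \<le> (1 + \<epsilon>) * (euclidean_norm x)\<^sup>2)"

definition sketch_orthogonal ::
    "'a::conjugatable_field mat \<Rightarrow> 'a vec \<Rightarrow> 'a vec \<Rightarrow> bool" where
  "sketch_orthogonal \<Omega> x y \<longleftrightarrow> conjugate (\<Omega> *\<^sub>v x) \<bullet> (\<Omega> *\<^sub>v y) = 0"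

definition sketch_orthonormal ::
    "'a::conjugatable_field mat \<Rightarrow> 'a mat \<Rightarrow> bool" where
  "sketch_orthonormal \<Omega> V \<longleftrightarrow> mat_adjoint (\<Omega> * V) * (\<Omega> * V) = 1\<^sub>m (dim_col V)"


section \<open>Randomized Arnoldi factorization\<close>

definition krylov :: "nat \<Rightarrow> real mat \<Rightarrow> real vec \<Rightarrow> nat \<Rightarrow> real vec set" where
  "krylov n A v m = span_in n ((\<lambda>j. (A ^\<^sub>m j) *\<^sub>v v) ` {..<m})"

definition randomized_arnoldi ::
    "nat \<Rightarrow> nat \<Rightarrow> real \<Rightarrow> real mat \<Rightarrow> real mat \<Rightarrow> real vec \<Rightarrow> nat \<Rightarrow>
     real mat \<Rightarrow> real mat \<Rightarrow> real vec \<Rightarrow> bool" where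
  "randomized_arnoldi n d \<epsilon> \<Omega> A v m V H r \<longleftrightarrow>
     A \<in> carrier_mat n n \<and> \<Omega> \<in> carrier_mat d n \<and>
     v \<in> carrier_vec n \<and> euclidean_norm (\<Omega> *\<^sub>v v) = 1 \<and>
     vectorspace.dim class_ring (module_vec TYPE(real) n\<lparr>carrier := krylov n A v m\<rparr>) = m \<and>
     eps_embedding \<epsilon> \<Omega> (span_in n (krylov n A v m \<union> (\<lambda>x. A *\<^sub>v x) ` krylov n A v m)) \<and>
     V \<in> carrier_mat n m \<and> sketch_orthonormal \<Omega> V \<and>
     distinct (cols V) \<and>
     vectorspace.basis class_ring (module_vec TYPE(real) n\<lparr>carrier := krylov n A v m\<rparr>)
       (set (cols V)) \<and>
     col V 0 = v \<and>
     H \<in> carrier_mat m m \<and> upper_hessenberg H \<and> (\<forall>j. j + 1 < m \<longrightarrow> 0 < H $$ (j + 1, j)) \<and>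
     r \<in> krylov n A v (m + 1) \<and> (\<forall>x \<in> krylov n A v m. sketch_orthogonal \<Omega> r x) \<and>
     A * V = V * H + outer_product r (unit_vec m (m - 1))"


section \<open>Shifted QR steps\<close>

definition qr_factorization ::
    "nat \<Rightarrow> 'a::conjugatable_field mat \<Rightarrow> 'a mat \<Rightarrow> 'a mat \<Rightarrow> bool" where
  "qr_factorization m M Q R \<longleftrightarrow>
     unitary_mat m Q \<and> R \<in> carrier_mat m m \<and> upper_triangular R \<and> M = Q * R"

text \<open>\<open>H\<^sup>+\<close> after \<open>i\<close> steps, the factors \<open>Q 1, \<dots>, Q i\<close> being given\<close>
fun qr_iterate :: "'a::conjugatable_field mat \<Rightarrow> (nat \<Rightarrow> 'a mat) \<Rightarrow> nat \<Rightarrow> 'a mat" where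
  "qr_iterate H Q 0 = H"
| "qr_iterate H Q (Suc i) = mat_adjoint (Q (Suc i)) * qr_iterate H Q i * Q (Suc i)"

text \<open>\<open>Q 1 * \<dots> * Q i\<close>\<close>
fun qr_product :: "nat \<Rightarrow> (nat \<Rightarrow> 'a::conjugatable_field mat) \<Rightarrow> nat \<Rightarrow> 'a mat" where
  "qr_product m Q 0 = 1\<^sub>m m"
| "qr_product m Q (Suc i) = qr_product m Q i * Q (Suc i)"

definition shifted_qr_steps ::
    "nat \<Rightarrow> nat \<Rightarrow> 'a::conjugatable_field mat \<Rightarrow> (nat \<Rightarrow> 'a) \<Rightarrow>
     (nat \<Rightarrow> 'a mat) \<Rightarrow> (nat \<Rightarrow> 'a mat) \<Rightarrow> bool" where
  "shifted_qr_steps m p H \<mu> Q R \<longleftrightarrow>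
     (\<forall>i\<in>{1..p}. qr_factorization m (qr_iterate H Q (i - 1) - \<mu> i \<cdot>\<^sub>m 1\<^sub>m m) (Q i) (R i) \<and>
                 upper_hessenberg (Q i))"

lemma mat_adjoint_mult:
  fixes M N :: "'a::conjugatable_field mat"
  assumes "M \<in> carrier_mat a b" "N \<in> carrier_mat b c"
  shows "mat_adjoint (M * N) = mat_adjoint N * mat_adjoint M"
  using assms
  by (intro eq_matI)
     (auto simp: scalar_prod_def sum_conjugate conjugate_dist_mul intro!: sum.cong)

lemma mat_adjoint_carrier [simp]:
  "M \<in> carrier_mat a b \<Longrightarrow> mat_adjoint M \<in> carrier_mat b a"
  by auto

lemma qr_product_carrier:
  assumes "\<And>i. i \<in> {1..p} \<Longrightarrow> Q i \<in> carrier_mat m m"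
  shows "qr_product m Q p \<in> carrier_mat m m"
  using assms
proof (induction p)
  case (Suc p)
  then have "qr_product m Q p \<in> carrier_mat m m" "Q (Suc p) \<in> carrier_mat m m" by auto
  then show ?case by simp
qed simp

lemma qr_iterate_eq_conjugation:
  fixes H :: "'a::conjugatable_field mat"
  assumes H: "H \<in> carrier_mat m m" and Q: "\<And>i. i \<in> {1..p} \<Longrightarrow> Q i \<in> carrier_mat m m"
  shows "qr_iterate H Q p = mat_adjoint (qr_product m Q p) * H * qr_product m Q p"
  using Q
proof (induction p)
  case 0
  have "mat_adjoint (1\<^sub>m m :: 'a mat) = 1\<^sub>m m"
  proof (rule eq_matI)
    fix i j assume "i < dim_row (1\<^sub>m m :: 'a mat)" "j < dim_col (1\<^sub>m m :: 'a mat)"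
    moreover have "conjugate (1::'a) = 1"
      by (metis conjugate_dist_mul conjugate_id mult.right_neutral mult.left_neutral)
    ultimately show "mat_adjoint (1\<^sub>m m :: 'a mat) $$ (i, j) = 1\<^sub>m m $$ (i, j)" by simp
  qed auto
  with H show ?case by simp
next
  case (Suc p)
  let ?P = "qr_product m Q p" and ?S = "Q (Suc p)"
  have P: "?P \<in> carrier_mat m m" using Suc.prems by (intro qr_product_carrier) auto
  have S: "?S \<in> carrier_mat m m" using Suc.prems by auto
  have IH: "qr_iterate H Q p = mat_adjoint ?P * H * ?P" using Suc by auto
  note aP = mat_adjoint_carrier[OF P] and aS = mat_adjoint_carrier[OF S]
  have "mat_adjoint ?S * (mat_adjoint ?P * H * ?P) * ?S
      = (mat_adjoint ?S * mat_adjoint ?P) * H * (?P * ?S)"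
    using aP aS P S H
    by (simp add: assoc_mult_mat[of _ m m _ m _ m] mult_carrier_mat[of _ m m _ m]
        del: mat_adjoint_carrier)
  then show ?case by (simp add: IH mat_adjoint_mult[OF P S])
qed

lemma qr_step_alternative:
  fixes M :: "'a::conjugatable_field mat"
  assumes M: "M \<in> carrier_mat m m" and qr: "qr_factorization m (M - \<mu> \<cdot>\<^sub>m 1\<^sub>m m) Q R"
  shows "mat_adjoint Q * M * Q = R * Q + \<mu> \<cdot>\<^sub>m 1\<^sub>m m"
proof -
  have Q: "Q \<in> carrier_mat m m" and R: "R \<in> carrier_mat m m"
    and u: "mat_adjoint Q * Q = 1\<^sub>m m" and e: "M - \<mu> \<cdot>\<^sub>m 1\<^sub>m m = Q * R"
    using qr by (auto simp: qr_factorization_def unitary_mat_def)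
  note aQ = mat_adjoint_carrier[OF Q]
  have I: "\<mu> \<cdot>\<^sub>m 1\<^sub>m m \<in> carrier_mat m m" by simp
  have "M = (M - \<mu> \<cdot>\<^sub>m 1\<^sub>m m) + \<mu> \<cdot>\<^sub>m 1\<^sub>m m" using M by (intro eq_matI) auto
  then have Meq: "M = Q * R + \<mu> \<cdot>\<^sub>m 1\<^sub>m m" using e by simp
  have QR: "Q * R \<in> carrier_mat m m" using Q R by simp
  have "mat_adjoint Q * M = (mat_adjoint Q * Q) * R + \<mu> \<cdot>\<^sub>m mat_adjoint Q"
    unfolding Meq using aQ Q R
    by (simp add: mult_add_distrib_mat[OF aQ QR I] mult_smult_distrib[OF aQ one_carrier_mat]
        assoc_mult_mat[OF aQ Q R])
  also have "\<dots> = R + \<mu> \<cdot>\<^sub>m mat_adjoint Q" using R by (simp add: u)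
  finally show ?thesis
    using aQ Q R u
    by (simp add: add_mult_distrib_mat[of _ m m _ _ m] mult_smult_assoc_mat[OF aQ Q])
qed

end

theory Submission
  imports Defs
begin

text \<open>
  Write \<open>m = k + p\<close>, \<open>QQ = Q 1 * \<dots> * Q p\<close> and \<open>W = V * QQ\<close>. Since \<open>QQ\<close> is unitary and
  \<open>H\<^sup>+ = QQ\<^sup>* * H * QQ\<close>, multiplying the Arnoldi relation on the right by \<open>QQ\<close> gives
  \<open>A * W = W * H\<^sup>+ + r * (e\<^sub>m\<^sup>T * QQ)\<close>, and \<open>W\<close> is again \<open>\<Omega>\<close>-orthonormal with \<open>r\<close> \<open>\<Omega>\<close>-orthogonal
  to its columns (\<open>sketch_orthonormal_mult_unitary\<close>, \<open>sketch_orthogonal_mult\<close>). The relation can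
  be cut off after \<open>k\<close> columns for two reasons, both about sparsity:

  \<^item> A QR step keeps the Hessenberg form, because it replaces the matrix by \<open>R * Q + \<mu> I\<close>
    (\<open>qr_iterate_upper_hessenberg\<close>). So among the first \<open>k\<close> columns of \<open>W * H\<^sup>+\<close> only the last one
    involves a column of \<open>W\<close> outside the first \<open>k\<close>, namely column \<open>k + 1\<close>.
  \<^item> A product of \<open>p\<close> Hessenberg matrices has at most \<open>p\<close> nonzero subdiagonals
    (\<open>qr_product_bandwidth\<close>), so the last row of \<open>QQ\<close> begins with \<open>k - 1\<close> zeros and \<open>r\<close> enters
    only column \<open>k\<close> as well.

  Both leftovers thus sit in column \<open>k\<close> and add up to the new residual, which is a combination of
  \<open>r\<close> and of column \<open>k + 1\<close> of \<open>W\<close>, hence \<open>\<Omega>\<close>-orthogonal to the first \<open>k\<close> columns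
  (\<open>arnoldi_truncation\<close>, \<open>implicit_restart\<close>). The argument is carried out over an arbitrary field
  with conjugation, so real shifts are the case of the given factorization itself; for complex
  shifts it is applied to the complexified factorization, which satisfies the same relations.
\<close>

section \<open>Sparsity along the QR steps\<close>

text \<open>In the sum for the entry \<open>(i, j)\<close> a term survives only if \<open>i \<le> l \<le> j + 1\<close>.\<close>
lemma upper_triangular_mult_hessenberg:
  fixes R Q :: "'a::comm_ring_1 mat"
  assumes R: "R \<in> carrier_mat m m" "upper_triangular R"
    and Q: "Q \<in> carrier_mat m m" "upper_hessenberg Q"
  shows "upper_hessenberg (R * Q)"
  unfolding upper_hessenberg_def
proof (intro allI impI)
  fix i j assume i: "i < dim_row (R * Q)" and j: "j < dim_col (R * Q)" and ij: "j + 1 < i"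
  have "(R * Q) $$ (i, j) = (\<Sum>l = 0..<m. R $$ (i, l) * Q $$ (l, j))"
    using i j R Q by (simp add: scalar_prod_def)
  also have "\<dots> = 0"
  proof (rule sum.neutral, intro ballI)
    fix l assume l: "l \<in> {0..<m}"
    show "R $$ (i, l) * Q $$ (l, j) = 0"
    proof (cases "l < i")
      case True
      then show ?thesis using R i by (auto simp: upper_triangular_def)
    next
      case False
      then show ?thesis using Q j l ij by (auto simp: upper_hessenberg_def)
    qed
  qed
  finally show "(R * Q) $$ (i, j) = 0" .
qed

lemma shifted_qr_steps_carrier:
  assumes "shifted_qr_steps m p H \<mu> Q R" "i \<in> {1..p}"
  shows "Q i \<in> carrier_mat m m"
  using assms by (auto simp: shifted_qr_steps_def qr_factorization_def unitary_mat_def)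

lemma shifted_qr_steps_SucD:
  "shifted_qr_steps m (Suc p) H \<mu> Q R \<Longrightarrow> shifted_qr_steps m p H \<mu> Q R"
  by (auto simp: shifted_qr_steps_def)

lemma qr_iterate_carrier:
  fixes H :: "'a::conjugatable_field mat"
  assumes "H \<in> carrier_mat m m" "\<And>i. i \<in> {1..p} \<Longrightarrow> Q i \<in> carrier_mat m m"
  shows "qr_iterate H Q p \<in> carrier_mat m m"
  using assms
proof (induction p)
  case (Suc p)
  have "qr_iterate H Q p \<in> carrier_mat m m" using Suc by auto
  moreover have "Q (Suc p) \<in> carrier_mat m m" using Suc.prems by auto
  ultimately show ?case by (auto intro!: mult_carrier_mat[of _ m m])
qed simp

lemma qr_iterate_upper_hessenberg:
  fixes H :: "'a::conjugatable_field mat"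
  assumes "H \<in> carrier_mat m m" "upper_hessenberg H" "shifted_qr_steps m p H \<mu> Q R"
  shows "upper_hessenberg (qr_iterate H Q p)"
  using assms(3)
proof (induction p)
  case 0
  then show ?case using assms by simp
next
  case (Suc p)
  let ?M = "qr_iterate H Q p" and ?S = "Q (Suc p)" and ?T = "R (Suc p)" and ?\<mu> = "\<mu> (Suc p)"
  have M: "?M \<in> carrier_mat m m"
    using Suc.prems assms(1)
    by (intro qr_iterate_carrier) (auto dest!: shifted_qr_steps_SucD intro: shifted_qr_steps_carrier)
  have qr: "qr_factorization m (?M - ?\<mu> \<cdot>\<^sub>m 1\<^sub>m m) ?S ?T" and S: "upper_hessenberg ?S"
    using Suc.prems by (auto simp: shifted_qr_steps_def dest!: bspec[of _ _ "Suc p"])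
  then have T: "?T \<in> carrier_mat m m" "upper_triangular ?T" and Sc: "?S \<in> carrier_mat m m"
    by (auto simp: qr_factorization_def unitary_mat_def)
  have "upper_hessenberg (?T * ?S)"
    using T Sc S by (rule upper_triangular_mult_hessenberg)
  then have "upper_hessenberg (?T * ?S + ?\<mu> \<cdot>\<^sub>m 1\<^sub>m m)"
    using T Sc by (auto simp: upper_hessenberg_def)
  then show ?case by (simp add: qr_step_alternative[OF M qr])
qed

text \<open>Every Hessenberg factor adds one subdiagonal to the profile of the product.\<close>
lemma qr_product_bandwidth:
  fixes H :: "'a::conjugatable_field mat"
  assumes "shifted_qr_steps m p H \<mu> Q R" "i < m" "j < m" "j + p < i"
  shows "qr_product m Q p $$ (i, j) = 0"
  using assms
proof (induction p arbitrary: i j)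
  case (Suc p)
  let ?P = "qr_product m Q p" and ?S = "Q (Suc p)"
  have S: "?S \<in> carrier_mat m m" "upper_hessenberg ?S"
    using Suc.prems(1) shifted_qr_steps_carrier[OF Suc.prems(1)]
    by (auto simp: shifted_qr_steps_def)
  have P: "?P \<in> carrier_mat m m"
    using Suc.prems(1)
    by (intro qr_product_carrier) (auto dest!: shifted_qr_steps_SucD intro: shifted_qr_steps_carrier)
  have "(?P * ?S) $$ (i, j) = (\<Sum>l = 0..<m. ?P $$ (i, l) * ?S $$ (l, j))"
    using Suc.prems P S by (simp add: scalar_prod_def)
  also have "\<dots> = 0"
  proof (rule sum.neutral, intro ballI)
    fix l assume l: "l \<in> {0..<m}"
    show "?P $$ (i, l) * ?S $$ (l, j) = 0"
    proof (cases "l + p < i")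
      case True
      then show ?thesis using Suc.IH[of i l] Suc.prems l by (auto dest: shifted_qr_steps_SucD)
    next
      case False
      then show ?thesis using S l Suc.prems by (auto simp: upper_hessenberg_def)
    qed
  qed
  finally show ?case by simp
qed simp

lemma unitary_mat_one: "unitary_mat m (1\<^sub>m m :: 'a::conjugatable_field mat)"
proof -
  have "conjugate (1::'a) = 1"
    by (metis conjugate_dist_mul conjugate_id mult.right_neutral mult.left_neutral)
  then have "mat_adjoint (1\<^sub>m m :: 'a mat) = 1\<^sub>m m" by (intro eq_matI) auto
  then show ?thesis by (simp add: unitary_mat_def)
qed

lemma unitary_mat_mult:
  fixes P S :: "'a::conjugatable_field mat"
  assumes "unitary_mat m P" "unitary_mat m S"
  shows "unitary_mat m (P * S)"
proof -
  have P: "P \<in> carrier_mat m m" "mat_adjoint P * P = 1\<^sub>m m" "P * mat_adjoint P = 1\<^sub>m m"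
    and S: "S \<in> carrier_mat m m" "mat_adjoint S * S = 1\<^sub>m m" "S * mat_adjoint S = 1\<^sub>m m"
    using assms by (auto simp: unitary_mat_def)
  note aP = mat_adjoint_carrier[OF P(1)] and aS = mat_adjoint_carrier[OF S(1)]
  have "mat_adjoint S * mat_adjoint P * (P * S) = mat_adjoint S * (mat_adjoint P * P) * S"
    using aP aS P(1) S(1)
    by (simp add: assoc_mult_mat[of _ m m _ m _ m] mult_carrier_mat[of _ m m _ m]
        del: mat_adjoint_carrier)
  moreover have "P * S * (mat_adjoint S * mat_adjoint P) = P * (S * mat_adjoint S) * mat_adjoint P"
    using aP aS P(1) S(1)
    by (simp add: assoc_mult_mat[of _ m m _ m _ m] mult_carrier_mat[of _ m m _ m]
        del: mat_adjoint_carrier)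
  ultimately show ?thesis
    using P S aP aS by (auto simp: unitary_mat_def mat_adjoint_mult[OF P(1) S(1)])
qed

lemma qr_product_unitary:
  fixes H :: "'a::conjugatable_field mat"
  assumes "shifted_qr_steps m p H \<mu> Q R"
  shows "unitary_mat m (qr_product m Q p)"
  using assms
proof (induction p)
  case (Suc p)
  then have "unitary_mat m (Q (Suc p))" by (auto simp: shifted_qr_steps_def qr_factorization_def)
  with Suc show ?case by (auto intro: unitary_mat_mult dest: shifted_qr_steps_SucD)
qed (simp add: unitary_mat_one)


section \<open>Orthogonality of sketches\<close>

lemma sketch_orthonormal_cols:
  fixes \<Omega> V :: "'a::conjugatable_field mat"
  assumes "\<Omega> \<in> carrier_mat d n" "V \<in> carrier_mat n m" "sketch_orthonormal \<Omega> V"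
    and "i < m" "j < m" "i \<noteq> j"
  shows "sketch_orthogonal \<Omega> (col V i) (col V j)"
proof -
  have "(mat_adjoint (\<Omega> * V) * (\<Omega> * V)) $$ (i, j) = 0"
    using assms by (simp add: sketch_orthonormal_def)
  moreover have "row (mat_adjoint (\<Omega> * V)) i = conjugate (\<Omega> *\<^sub>v col V i)"
    using assms by (intro eq_vecI) auto
  moreover have "col (\<Omega> * V) j = \<Omega> *\<^sub>v col V j"
    using assms by (intro eq_vecI) auto
  ultimately show ?thesis using assms by (simp add: sketch_orthogonal_def)
qed

lemma sketch_orthonormal_mult_unitary:
  fixes \<Omega> V P :: "'a::conjugatable_field mat"
  assumes \<Omega>: "\<Omega> \<in> carrier_mat d n" and V: "V \<in> carrier_mat n m"
    and on: "sketch_orthonormal \<Omega> V" and P: "unitary_mat m P"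
  shows "sketch_orthonormal \<Omega> (V * P)"
proof -
  let ?S = "\<Omega> * V"
  have Pc: "P \<in> carrier_mat m m" and u: "mat_adjoint P * P = 1\<^sub>m m"
    using P by (auto simp: unitary_mat_def)
  have S: "?S \<in> carrier_mat d m" using \<Omega> V by simp
  have on': "mat_adjoint ?S * ?S = 1\<^sub>m m" using on V by (simp add: sketch_orthonormal_def)
  note aP = mat_adjoint_carrier[OF Pc] and aS = mat_adjoint_carrier[OF S]
  have "mat_adjoint (?S * P) * (?S * P) = mat_adjoint P * (mat_adjoint ?S * (?S * P))"
    unfolding mat_adjoint_mult[OF S Pc] by (rule assoc_mult_mat[OF aP aS mult_carrier_mat[OF S Pc]])
  also have "mat_adjoint ?S * (?S * P) = P"
    using Pc by (simp add: assoc_mult_mat[OF aS S Pc, symmetric] on')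
  finally show ?thesis
    using Pc u by (simp add: sketch_orthonormal_def assoc_mult_mat[OF \<Omega> V Pc])
qed

text \<open>Orthogonality to all columns of \<open>V\<close> says that the adjoint of \<open>\<Omega> * V\<close> annihilates \<open>\<Omega> r\<close>; this
  passes to any linear combination of the columns. The proof uses the transpose and puts the
  conjugation on \<open>\<Omega> r\<close>, where the definition of the inner product has it.\<close>
lemma sketch_orthogonal_mult:
  fixes \<Omega> V P :: "'a::conjugatable_field mat"
  assumes \<Omega>: "\<Omega> \<in> carrier_mat d n" and V: "V \<in> carrier_mat n m" and P: "P \<in> carrier_mat m m'"
    and r: "r \<in> carrier_vec n" and orth: "\<And>l. l < m \<Longrightarrow> sketch_orthogonal \<Omega> r (col V l)"
    and j: "j < m'"
  shows "sketch_orthogonal \<Omega> r (col (V * P) j)"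
proof -
  let ?c = "conjugate (\<Omega> *\<^sub>v r)"
  have c: "?c \<in> carrier_vec d" using \<Omega> r by auto
  have S: "\<Omega> * V \<in> carrier_mat d m" using \<Omega> V by simp
  have zero: "transpose_mat (\<Omega> * V) *\<^sub>v ?c = 0\<^sub>v m"
  proof (rule eq_vecI)
    fix l assume l: "l < dim_vec (0\<^sub>v m :: 'a vec)"
    have "col (\<Omega> * V) l = \<Omega> *\<^sub>v col V l" using l \<Omega> V by (intro eq_vecI) auto
    moreover have "\<Omega> *\<^sub>v col V l \<in> carrier_vec d"
      using V by (intro mult_mat_vec_carrier[OF \<Omega>]) auto
    ultimately show "(transpose_mat (\<Omega> * V) *\<^sub>v ?c) $ l = 0\<^sub>v m $ l"
      using orth[of l] l V comm_scalar_prod[OF c] by (simp add: sketch_orthogonal_def)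
  qed (use V in simp)
  have "\<Omega> *\<^sub>v col (V * P) j = (\<Omega> * V) *\<^sub>v col P j"
    using \<Omega> V P j by (simp add: col_mult2[OF V P j] assoc_mult_mat_vec[OF \<Omega> V])
  moreover have "?c \<bullet> ((\<Omega> * V) *\<^sub>v col P j) = (transpose_mat (\<Omega> * V) *\<^sub>v ?c) \<bullet> col P j"
    using transpose_vec_mult_scalar[OF S _ c, of "col P j"] carrier_vecI[of "col P j" m] P by simp
  ultimately show ?thesis using P scalar_prod_left_zero[of "col P j" m] carrier_vecI[of "col P j" m]
    by (simp add: sketch_orthogonal_def zero)
qed

lemma sketch_orthogonal_combination:
  fixes \<Omega> :: "'a::conjugatable_field mat"
  assumes \<Omega>: "\<Omega> \<in> carrier_mat d n"
    and x: "x \<in> carrier_vec n" and y: "y \<in> carrier_vec n" and z: "z \<in> carrier_vec n"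
    and "sketch_orthogonal \<Omega> x z" "sketch_orthogonal \<Omega> y z"
  shows "sketch_orthogonal \<Omega> (a \<cdot>\<^sub>v x + b \<cdot>\<^sub>v y) z"
proof -
  have c: "\<Omega> *\<^sub>v x \<in> carrier_vec d" "\<Omega> *\<^sub>v y \<in> carrier_vec d" "\<Omega> *\<^sub>v z \<in> carrier_vec d"
    using \<Omega> x y z by auto
  have "\<Omega> *\<^sub>v (a \<cdot>\<^sub>v x + b \<cdot>\<^sub>v y) = a \<cdot>\<^sub>v (\<Omega> *\<^sub>v x) + b \<cdot>\<^sub>v (\<Omega> *\<^sub>v y)"
    using \<Omega> x y by (simp add: mult_add_distrib_mat_vec[OF \<Omega>] mult_mat_vec[OF \<Omega>])
  then have "conjugate (\<Omega> *\<^sub>v (a \<cdot>\<^sub>v x + b \<cdot>\<^sub>v y))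
      = conjugate a \<cdot>\<^sub>v conjugate (\<Omega> *\<^sub>v x) + conjugate b \<cdot>\<^sub>v conjugate (\<Omega> *\<^sub>v y)"
    using c by (simp add: conjugate_add_vec[of _ d] conjugate_smult_vec)
  then show ?thesis
    using assms(5,6) c
    by (simp add: sketch_orthogonal_def add_scalar_prod_distrib[of _ d])
qed


section \<open>Truncating the relation\<close>

lemma leading_block_carrier [simp]: "leading_block M a b \<in> carrier_mat a b"
  by (simp add: leading_block_def)

lemma col_leading_block:
  assumes "M \<in> carrier_mat a b" "c \<le> b" "j < c"
  shows "col (leading_block M a c) j = col M j"
  using assms by (intro eq_vecI) (auto simp: leading_block_def)

lemma mult_leading_block:
  fixes V P :: "'a::comm_ring_1 mat"
  assumes V: "V \<in> carrier_mat n m" and P: "P \<in> carrier_mat m b" and "k \<le> b"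
  shows "V * leading_block P m k = leading_block (V * P) n k"
proof (rule eq_matI)
  fix i j assume "i < dim_row (leading_block (V * P) n k)" "j < dim_col (leading_block (V * P) n k)"
  then have "i < n" "j < k" by (auto simp: leading_block_def)
  then show "(V * leading_block P m k) $$ (i, j) = leading_block (V * P) n k $$ (i, j)"
    using assms col_leading_block[OF P, of k j] by (simp add: leading_block_def)
qed (use V in \<open>auto simp: leading_block_def\<close>)

lemma sketch_orthonormal_leading_block:
  fixes \<Omega> W :: "'a::conjugatable_field mat"
  assumes \<Omega>: "\<Omega> \<in> carrier_mat d n" and W: "W \<in> carrier_mat n m" and k: "k \<le> m"
    and on: "sketch_orthonormal \<Omega> W"
  shows "sketch_orthonormal \<Omega> (leading_block W n k)"
proof -
  let ?S = "\<Omega> * W"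
  have S: "?S \<in> carrier_mat d m" using \<Omega> W by simp
  have on': "mat_adjoint ?S * ?S = 1\<^sub>m m" using on W by (simp add: sketch_orthonormal_def)
  have B: "\<Omega> * leading_block W n k = leading_block ?S d k" by (rule mult_leading_block[OF \<Omega> W k])
  have "mat_adjoint (leading_block ?S d k) * leading_block ?S d k = 1\<^sub>m k"
  proof (rule eq_matI)
    fix i j assume "i < dim_row (1\<^sub>m k :: 'a mat)" "j < dim_col (1\<^sub>m k :: 'a mat)"
    then have i: "i < k" and j: "j < k" by auto
    have "row (mat_adjoint (leading_block ?S d k)) i = row (mat_adjoint ?S) i"
      using i k S by (intro eq_vecI) (auto simp: leading_block_def simp del: index_mult_mat)
    then have "(mat_adjoint (leading_block ?S d k) * leading_block ?S d k) $$ (i, j)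
        = (mat_adjoint ?S * ?S) $$ (i, j)"
      using i j k S W col_leading_block[OF S k j] by (simp add: leading_block_def)
    then show "(mat_adjoint (leading_block ?S d k) * leading_block ?S d k) $$ (i, j) = 1\<^sub>m k $$ (i, j)"
      using i j k by (simp add: on')
  qed (auto simp: leading_block_def)
  then show ?thesis by (simp add: sketch_orthonormal_def B) (simp add: leading_block_def)
qed

text \<open>This is \<open>(r * e\<^sub>l\<^sup>T) * P = r * (e\<^sub>l\<^sup>T * P)\<close>: the residual spreads over the columns according to
  one row of \<open>P\<close>.\<close>
lemma outer_product_mult:
  fixes P :: "'a::comm_ring_1 mat"
  assumes "P \<in> carrier_mat m b" "l < m"
  shows "outer_product r (unit_vec m l) * P = outer_product r (row P l)"
proof (rule eq_matI)
  fix i j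
  assume "i < dim_row (outer_product r (row P l))" "j < dim_col (outer_product r (row P l))"
  then have i: "i < dim_vec r" and j: "j < b" using assms by (auto simp: outer_product_def)
  have "row (outer_product r (unit_vec m l)) i = r $ i \<cdot>\<^sub>v unit_vec m l"
    using i by (intro eq_vecI) (auto simp: outer_product_def)
  then show "(outer_product r (unit_vec m l) * P) $$ (i, j) = outer_product r (row P l) $$ (i, j)"
    using i j assms by (simp add: outer_product_def)
qed (use assms in \<open>auto simp: outer_product_def\<close>)

text \<open>In a column \<open>j < k\<close> of the relation the Hessenberg form of \<open>M\<close> kills all terms
  \<open>W(i,l) * M(l,j)\<close> with \<open>l > k\<close>, and for \<open>j < k - 1\<close> also the one with \<open>l = k\<close>.\<close>
lemma arnoldi_truncation:
  fixes A W M :: "'a::comm_ring_1 mat"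
  assumes A: "A \<in> carrier_mat n n" and W: "W \<in> carrier_mat n m" and M: "M \<in> carrier_mat m m"
    and hess: "upper_hessenberg M" and r: "r \<in> carrier_vec n" and s: "s \<in> carrier_vec m"
    and rel: "A * W = W * M + outer_product r s"
    and k: "1 \<le> k" "k < m" and s0: "\<And>j. j + 1 < k \<Longrightarrow> s $ j = 0"
  shows "A * leading_block W n k = leading_block W n k * leading_block M k k
    + outer_product (M $$ (k, k - 1) \<cdot>\<^sub>v col W k + s $ (k - 1) \<cdot>\<^sub>v r) (unit_vec k (k - 1))"
    (is "?L = ?B + ?O")
proof (rule eq_matI)
  show "dim_row ?L = dim_row (?B + ?O)" "dim_col ?L = dim_col (?B + ?O)"
    using A W r by (auto simp: outer_product_def leading_block_def)
  fix i j assume "i < dim_row (?B + ?O)" "j < dim_col (?B + ?O)"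
  then have i: "i < n" and j: "j < k" using r by (auto simp: outer_product_def)
  let ?f = "\<lambda>l. W $$ (i, l) * M $$ (l, j)"
  have "?L $$ (i, j) = (A * W) $$ (i, j)"
    using A W i j k col_leading_block[OF W, of k j] by (simp add: leading_block_def)
  also have "\<dots> = (\<Sum>l = 0..<m. ?f l) + r $ i * s $ j"
    using rel W M r s i j k by (simp add: outer_product_def scalar_prod_def)
  also have "(\<Sum>l = 0..<m. ?f l) = (\<Sum>l = 0..<Suc k. ?f l)"
  proof (rule sum.mono_neutral_right)
    show "\<forall>l\<in>{0..<m} - {0..<Suc k}. ?f l = 0"
      using hess M j k by (auto simp: upper_hessenberg_def)
  qed (use k in auto)
  also have "\<dots> = (\<Sum>l = 0..<k. ?f l) + ?f k" by simp
  also have "(\<Sum>l = 0..<k. ?f l) = ?B $$ (i, j)"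
    using i j by (simp add: leading_block_def scalar_prod_def)
  finally have eq: "?L $$ (i, j) = ?B $$ (i, j) + ?f k + r $ i * s $ j" .
  have O: "?O $$ (i, j) = (if j = k - 1 then ?f k + r $ i * s $ j else 0)"
    using i j k W r by (auto simp: outer_product_def algebra_simps)
  show "?L $$ (i, j) = (?B + ?O) $$ (i, j)"
  proof (cases "j = k - 1")
    case True
    then show ?thesis using eq O i j r by (simp add: outer_product_def add.assoc)
  next
    case False
    then have "j + 1 < k" using j by simp
    then have "M $$ (k, j) = 0" "s $ j = 0" using hess M k s0 by (auto simp: upper_hessenberg_def)
    then show ?thesis using eq O i j r False by (simp add: outer_product_def)
  qed
qed


section \<open>Implicit restart\<close>

lemma implicit_restart:
  fixes \<Omega> A V H :: "'a::conjugatable_field mat"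
  assumes k: "1 \<le> k" and p: "1 \<le> p"
    and A: "A \<in> carrier_mat n n" and \<Omega>: "\<Omega> \<in> carrier_mat d n"
    and V: "V \<in> carrier_mat n (k + p)" and H: "H \<in> carrier_mat (k + p) (k + p)"
    and r: "r \<in> carrier_vec n" and hess: "upper_hessenberg H" and on: "sketch_orthonormal \<Omega> V"
    and orth: "\<And>j. j < k + p \<Longrightarrow> sketch_orthogonal \<Omega> r (col V j)"
    and rel: "A * V = V * H + outer_product r (unit_vec (k + p) (k + p - 1))"
    and qr: "shifted_qr_steps (k + p) p H \<mu> Q R"
  defines "QQ \<equiv> qr_product (k + p) Q p" and "Hplus \<equiv> qr_iterate H Q p"
  defines "Vt \<equiv> V * leading_block QQ (k + p) k" and "Ht \<equiv> leading_block Hplus k k"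
    and "rt \<equiv> Hplus $$ (k, k - 1) \<cdot>\<^sub>v (V *\<^sub>v col QQ k) + QQ $$ (k + p - 1, k - 1) \<cdot>\<^sub>v r"
  shows "A * Vt = Vt * Ht + outer_product rt (unit_vec k (k - 1))"
    and "sketch_orthonormal \<Omega> Vt"
    and "upper_hessenberg Ht"
    and "\<forall>j<k. sketch_orthogonal \<Omega> rt (col Vt j)"
proof -
  define m where "m = k + p"
  define W where "W = V * QQ"
  have km: "k < m" using p by (simp add: m_def)
  note V = V[folded m_def] and H = H[folded m_def] and qr = qr[folded m_def]
  have Qc: "Q i \<in> carrier_mat m m" if "i \<in> {1..p}" for i
    using shifted_qr_steps_carrier[OF qr that] .
  have u: "unitary_mat m QQ" unfolding QQ_def m_def[symmetric] by (rule qr_product_unitary[OF qr])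
  then have QQ: "QQ \<in> carrier_mat m m" and QQi: "QQ * mat_adjoint QQ = 1\<^sub>m m"
    by (auto simp: unitary_mat_def)
  note aQQ = mat_adjoint_carrier[OF QQ]
  have W: "W \<in> carrier_mat n m" using V QQ by (simp add: W_def)
  have Hp: "Hplus \<in> carrier_mat m m" unfolding Hplus_def by (rule qr_iterate_carrier[OF H Qc])
  have hp: "upper_hessenberg Hplus" unfolding Hplus_def
    by (rule qr_iterate_upper_hessenberg[OF H hess qr])
  have Hpe: "Hplus = mat_adjoint QQ * H * QQ" unfolding Hplus_def QQ_def m_def[symmetric]
    by (rule qr_iterate_eq_conjugation[OF H Qc])
  have HQ: "H * QQ \<in> carrier_mat m m" using H QQ by simp
  have "QQ * Hplus = (QQ * mat_adjoint QQ) * (H * QQ)"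
    unfolding Hpe using assoc_mult_mat[OF aQQ H QQ] assoc_mult_mat[OF QQ aQQ HQ] by simp
  then have comm: "QQ * Hplus = H * QQ" using left_mult_one_mat[OF HQ] by (simp add: QQi)

  have Wrel: "A * W = W * Hplus + outer_product r (row QQ (m - 1))"
  proof -
    have O: "outer_product r (unit_vec m (m - 1)) \<in> carrier_mat n m"
      using r by (auto simp: outer_product_def)
    have "A * W = (A * V) * QQ" using assoc_mult_mat[OF A V QQ] by (simp add: W_def)
    also have "\<dots> = V * H * QQ + outer_product r (unit_vec m (m - 1)) * QQ"
      using add_mult_distrib_mat[OF _ O QQ, of "V * H"] V H by (simp add: rel m_def)
    also have "V * H * QQ = W * Hplus"
      using assoc_mult_mat[OF V H QQ] assoc_mult_mat[OF V QQ Hp] by (simp add: W_def comm)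
    also have "outer_product r (unit_vec m (m - 1)) * QQ = outer_product r (row QQ (m - 1))"
      using km by (intro outer_product_mult[OF QQ]) simp
    finally show ?thesis .
  qed
  have Vt: "Vt = leading_block W n k"
    unfolding Vt_def W_def m_def[symmetric] using km by (intro mult_leading_block[OF V QQ]) simp
  have rt: "rt = Hplus $$ (k, k - 1) \<cdot>\<^sub>v col W k + row QQ (m - 1) $ (k - 1) \<cdot>\<^sub>v r"
    using km QQ by (simp add: rt_def W_def col_mult2[OF V QQ] m_def)
  have "row QQ (m - 1) $ j = 0" if "j + 1 < k" for j
    using qr_product_bandwidth[OF qr, of "m - 1" j] that QQ by (simp add: QQ_def m_def)
  then show "A * Vt = Vt * Ht + outer_product rt (unit_vec k (k - 1))"
    unfolding Vt Ht_def rt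
    using QQ by (intro arnoldi_truncation[OF A W Hp hp r _ Wrel k km]) auto
  have onW: "sketch_orthonormal \<Omega> W"
    unfolding W_def by (rule sketch_orthonormal_mult_unitary[OF \<Omega> V on u])
  then show "sketch_orthonormal \<Omega> Vt"
    unfolding Vt using km by (intro sketch_orthonormal_leading_block[OF \<Omega> W]) simp
  show "upper_hessenberg Ht"
    using hp Hp km by (auto simp: Ht_def upper_hessenberg_def leading_block_def)
  show "\<forall>j<k. sketch_orthogonal \<Omega> rt (col Vt j)"
  proof (intro allI impI)
    fix j assume j: "j < k"
    have "sketch_orthogonal \<Omega> (col W k) (col W j)"
      using j km by (intro sketch_orthonormal_cols[OF \<Omega> W onW]) auto
    moreover have "sketch_orthogonal \<Omega> r (col W j)"
      unfolding W_def using j km orth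
      by (intro sketch_orthogonal_mult[OF \<Omega> V QQ r]) (auto simp: m_def)
    ultimately have "sketch_orthogonal \<Omega> rt (col W j)"
      unfolding rt using W r by (intro sketch_orthogonal_combination[OF \<Omega>]) auto
    then show "sketch_orthogonal \<Omega> rt (col Vt j)"
      using col_leading_block[OF W, of k j] j km by (simp add: Vt)
  qed
qed


section \<open>From the Arnoldi factorization to its complexification\<close>

lemma krylov_carrier:
  assumes "A \<in> carrier_mat n n" "v \<in> carrier_vec n"
  shows "krylov n A v m \<subseteq> carrier_vec n"
proof -
  interpret vec_space "TYPE(real)" n .
  have "(\<lambda>j. (A ^\<^sub>m j) *\<^sub>v v) ` {..<m} \<subseteq> carrier_vec n"
    using assms by (auto intro!: mult_mat_vec_carrier[of _ n n])
  then show ?thesis unfolding krylov_def by (auto dest: span_closed)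
qed

text \<open>The residual is \<open>\<Omega>\<close>-orthogonal to the columns of \<open>V\<close> because these form a basis of the Krylov
  space, in particular lie in it.\<close>
lemma randomized_arnoldi_residual:
  assumes "randomized_arnoldi n d \<epsilon> \<Omega> A v m V H r"
  shows "r \<in> carrier_vec n" and "\<And>j. j < m \<Longrightarrow> sketch_orthogonal \<Omega> r (col V j)"
proof -
  show "r \<in> carrier_vec n"
    using assms krylov_carrier[of A n v "m + 1"] by (auto simp: randomized_arnoldi_def)
  have V: "V \<in> carrier_mat n m" using assms by (simp add: randomized_arnoldi_def)
  interpret vec_space "TYPE(real)" n .
  have sub: "set (cols V) \<subseteq> krylov n A v m"
  proof -
    have sm: "submodule class_ring (krylov n A v m) (module_vec TYPE(real) n)"
      unfolding krylov_def using assms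
      by (intro span_is_submodule)
        (auto simp: randomized_arnoldi_def intro!: mult_mat_vec_carrier[of _ n n])
    have "vectorspace class_ring (module_vec TYPE(real) n\<lparr>carrier := krylov n A v m\<rparr>)"
      using submodule_is_module[OF sm] vectorspace_axioms by (simp add: vectorspace_def)
    from vectorspace.basis_def[OF this] show ?thesis
      using assms by (simp add: randomized_arnoldi_def)
  qed
  fix j assume "j < m"
  then have "col V j \<in> set (cols V)" using V by (auto simp: cols_def)
  with sub show "sketch_orthogonal \<Omega> r (col V j)"
    using assms by (auto simp: randomized_arnoldi_def)
qed

lemma mat_adjoint_of_real:
  "mat_adjoint (map_mat complex_of_real M) = map_mat complex_of_real (mat_adjoint M)"
  by (intro eq_matI) auto

lemma upper_hessenberg_of_real:
  "upper_hessenberg M \<Longrightarrow> upper_hessenberg (map_mat complex_of_real M)"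
  by (auto simp: upper_hessenberg_def)

lemma sketch_orthonormal_of_real:
  assumes \<Omega>: "\<Omega> \<in> carrier_mat d n" and V: "V \<in> carrier_mat n m" and on: "sketch_orthonormal \<Omega> V"
  shows "sketch_orthonormal (map_mat complex_of_real \<Omega>) (map_mat complex_of_real V)"
proof -
  have S: "\<Omega> * V \<in> carrier_mat d m" using \<Omega> V by simp
  have "mat_adjoint (\<Omega> * V) * (\<Omega> * V) = 1\<^sub>m m" using on V by (simp add: sketch_orthonormal_def)
  then show ?thesis
    using V by (simp add: sketch_orthonormal_def mat_adjoint_of_real of_real_hom.mat_hom_one
        of_real_hom.mat_hom_mult[OF \<Omega> V, symmetric]
        of_real_hom.mat_hom_mult[OF mat_adjoint_carrier[OF S] S, symmetric])
qed

lemma sketch_orthogonal_of_real: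
  assumes \<Omega>: "\<Omega> \<in> carrier_mat d n" and "x \<in> carrier_vec n" "y \<in> carrier_vec n"
    and "sketch_orthogonal \<Omega> x y"
  shows "sketch_orthogonal (map_mat complex_of_real \<Omega>)
    (map_vec complex_of_real x) (map_vec complex_of_real y)"
proof -
  have mv: "map_mat complex_of_real \<Omega> *\<^sub>v map_vec complex_of_real z
      = map_vec complex_of_real (\<Omega> *\<^sub>v z)" if "z \<in> carrier_vec n" for z
    by (rule of_real_hom.mult_mat_vec_hom[OF \<Omega> that, symmetric])
  have "(\<Sum>i = 0..<d. complex_of_real ((\<Omega> *\<^sub>v x) $ i) * complex_of_real ((\<Omega> *\<^sub>v y) $ i))
      = complex_of_real (\<Sum>i = 0..<d. (\<Omega> *\<^sub>v x) $ i * (\<Omega> *\<^sub>v y) $ i)"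
    by (simp only: of_real_sum of_real_mult)
  then show ?thesis
    using assms by (simp add: sketch_orthogonal_def mv scalar_prod_def of_real_mult [symmetric] of_real_sum [symmetric]
        del: index_mult_mat_vec of_real_mult of_real_sum)
qed

lemma outer_product_of_real:
  "outer_product (map_vec complex_of_real x) (map_vec complex_of_real y)
    = map_mat complex_of_real (outer_product x y)"
  by (intro eq_matI) (auto simp: outer_product_def)

lemma unit_vec_of_real: "map_vec complex_of_real (unit_vec m i) = unit_vec m i"
  by (intro eq_vecI) (auto simp: unit_vec_def)

lemma arnoldi_relation_of_real:
  assumes A: "A \<in> carrier_mat n n" and V: "V \<in> carrier_mat n m" and H: "H \<in> carrier_mat m m"
    and r: "r \<in> carrier_vec n" and rel: "A * V = V * H + outer_product r (unit_vec m l)"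
  shows "map_mat complex_of_real A * map_mat complex_of_real V
    = map_mat complex_of_real V * map_mat complex_of_real H
      + outer_product (map_vec complex_of_real r) (unit_vec m l)"
proof -
  have add: "map_mat complex_of_real (X + Y) = map_mat complex_of_real X + map_mat complex_of_real Y"
    if "X \<in> carrier_mat n m" "Y \<in> carrier_mat n m" for X Y
    using that by (intro eq_matI) auto
  have "outer_product r (unit_vec m l) \<in> carrier_mat n m" using r by (auto simp: outer_product_def)
  from add[OF mult_carrier_mat[OF V H] this] show ?thesis
    using of_real_hom.mat_hom_mult[OF A V, where ?'a = complex]
      of_real_hom.mat_hom_mult[OF V H, where ?'a = complex]
      outer_product_of_real[of r "unit_vec m l"]
    by (simp add: rel unit_vec_of_real)
qed

theorem mainTheorem7:
  fixes n d k p :: nat and \<epsilon> :: real and \<Omega> A V H :: "real mat" and v r :: "real vec"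
  assumes "1 \<le> k" and "1 \<le> p"
    and "randomized_arnoldi n d \<epsilon> \<Omega> A v (k + p) V H r"
  shows
    "(\<forall>(\<mu> :: nat \<Rightarrow> real) Q R. shifted_qr_steps (k + p) p H \<mu> Q R \<longrightarrow>
       (let QQ = qr_product (k + p) Q p;
            Hplus = qr_iterate H Q p;
            Vt = V * leading_block QQ (k + p) k;
            Ht = leading_block Hplus k k;
            rt = Hplus $$ (k, k - 1) \<cdot>\<^sub>v (V *\<^sub>v col QQ k) + QQ $$ (k + p - 1, k - 1) \<cdot>\<^sub>v r
        in A * Vt = Vt * Ht + outer_product rt (unit_vec k (k - 1)) \<and>
           sketch_orthonormal \<Omega> Vt \<and>
           upper_hessenberg Ht \<and>
           (\<forall>j<k. sketch_orthogonal \<Omega> rt (col Vt j))))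
     \<and>
     (\<forall>(\<mu> :: nat \<Rightarrow> complex) Q R.
       (let Ac = map_mat complex_of_real A;
            \<Omega>c = map_mat complex_of_real \<Omega>;
            Vc = map_mat complex_of_real V;
            Hc = map_mat complex_of_real H;
            rc = map_vec complex_of_real r
        in shifted_qr_steps (k + p) p Hc \<mu> Q R \<longrightarrow>
       (let QQ = qr_product (k + p) Q p;
            Hplus = qr_iterate Hc Q p;
            Vt = Vc * leading_block QQ (k + p) k;
            Ht = leading_block Hplus k k;
            rt = Hplus $$ (k, k - 1) \<cdot>\<^sub>v (Vc *\<^sub>v col QQ k) + QQ $$ (k + p - 1, k - 1) \<cdot>\<^sub>v rc
        in Ac * Vt = Vt * Ht + outer_product rt (unit_vec k (k - 1)) \<and>
           sketch_orthonormal \<Omega>c Vt \<and>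
           upper_hessenberg Ht \<and>
           (\<forall>j<k. sketch_orthogonal \<Omega>c rt (col Vt j)))))"
proof (intro conjI allI impI, goal_cases)
  case (1 \<mu> Q R)
  note arn = assms(3)[unfolded randomized_arnoldi_def]
  note res = randomized_arnoldi_residual[OF assms(3)]
  show ?case
    unfolding Let_def using arn
    by (intro conjI implicit_restart[OF assms(1,2) _ _ _ _ res(1) _ _ res(2) _ 1]) auto
next
  case (2 \<mu> Q R)
  note res = randomized_arnoldi_residual[OF assms(3)]
  have A: "A \<in> carrier_mat n n" and \<Omega>: "\<Omega> \<in> carrier_mat d n" and V: "V \<in> carrier_mat n (k + p)"
    and H: "H \<in> carrier_mat (k + p) (k + p)" and hess: "upper_hessenberg H"
    and on: "sketch_orthonormal \<Omega> V"
    and rel: "A * V = V * H + outer_product r (unit_vec (k + p) (k + p - 1))"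
    using assms(3) by (auto simp: randomized_arnoldi_def)
  let ?M = "map_mat complex_of_real"
  have c: "?M A \<in> carrier_mat n n" "?M \<Omega> \<in> carrier_mat d n" "?M V \<in> carrier_mat n (k + p)"
    "?M H \<in> carrier_mat (k + p) (k + p)" "map_vec complex_of_real r \<in> carrier_vec n"
    using A \<Omega> V H res(1) by auto
  have orth: "sketch_orthogonal (?M \<Omega>) (map_vec complex_of_real r) (col (?M V) j)"
    if "j < k + p" for j
    using sketch_orthogonal_of_real[OF \<Omega> res(1) _ res(2)[OF that]] V that by simp
  note restart = implicit_restart[OF assms(1,2) c upper_hessenberg_of_real[OF hess]
      sketch_orthonormal_of_real[OF \<Omega> V on] orth arnoldi_relation_of_real[OF A V H res(1) rel]]
  show ?case
    unfolding Let_def by (intro impI conjI restart)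
qed

end
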